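(* Let $X$ be a non-empty set, let $Y$ be a real or complex Hausdorff locally convex topological vector space, let $E$ be a closed subset of $Y$ such that $Y\setminus E$ is convex, let $I\subseteq\mathbf{R}$ be an interval with $0\in I$, and let $\Phi,\Psi$ be two multifunctions from $X$ into $Y$, with non-empty compact values. Assume that: $(h_1)$ for each $x\in X$, there exists $\lambda\in I$ such that $\Phi(x)+\lambda\Psi(x)\subseteq Y\setminus E$; $(h_2)$ the set $\Phi^{-}(\mathrm{int}(E))$ is non-empty; $(h_3)$ there exists a set $D\subseteq I$ dense in $I$ such that, for every set $A\subseteq D$ for which $$\bigcap_{\lambda\in B\cup\{0\}}(\Phi+\lambda\Psi)^{-}(E)\neq\emptyset$$ for each finite set $B\subseteq A$, one has $$\bigcap_{\lambda\in A\cup\{0\}}(\Phi+\lambda\Psi)^{-}(E)\neq\emptyset .$$ Then there exist a compact interval $[a^*,b^*]\subseteq I$ and a point $x^*\in\Phi^{-}(E)$, with $$\bigcup_{\lambda\in ]a^*,b^*[}(\Phi(x^* )+\lambda\Psi(x^* ))\subseteq Y\setminus E,$$ such that, if we put $$V=\bigcup_{\lambda\in ]a^*,b^*[}(\Phi+\lambda\Psi)^{+}(Y\setminus E),$$ at least one of the following holds: $(q_1)$ $a^*>0$, $(\Phi(x^* )+a^*\Psi(x^* ))\cap E\neq\emptyset$ and $$(\Phi+a^*\Psi)(V)\cap E\subseteq\partial(\Phi+a^*\Psi)(V)\cap\partial E;$$ $(q_2)$ $b^*<0$, $(\Phi+b^*\Psi)(V)\cap E\neq\emptyset$ and $$(\Phi+b^*\Psi)(V)\cap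 E\subseteq\partial(\Phi+b^*\Psi)(V)\cap\partial E.$$ In particular, $(q_1)$ (resp. $(q_2)$) holds when $0=\inf I$ (resp. $0=\sup I$).
   Context: An "interval" means a non-empty connected subset of $\mathbf{R}$ with more than one point (so $a^*<b^*$ for a compact interval $[a^*,b^*]$); $]a,b[$ denotes the open interval with endpoints $a,b$. A multifunction $F$ from $X$ into $Y$ assigns to each $x\in X$ a subset $F(x)$ of $Y$. For $A\subseteq X$ and $B\subseteq Y$, put $F(A)=\bigcup_{x\in A}F(x)$, $F^{-}(B)=\{x\in X: F(x)\cap B\neq\emptyset\}$ and $F^{+}(B)=\{x\in X: F(x)\subseteq B\}$. The multifunction $\Phi+\lambda\Psi$ is $x\mapsto \Phi(x)+\lambda\Psi(x)=\{u+\lambda v: u\in\Phi(x), v\in\Psi(x)\}$. $\mathrm{int}$ and $\partial$ denote interior and boundary in $Y$. *)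

theory Defs
  imports "HOL-Analysis.Analysis"
begin

text \<open>
  A locally convex topological vector space over the reals or over the complex numbers. A field of
  class \<^class>\<open>real_normed_field\<close> is, up to isomorphism, one of these two (Gelfand--Mazur), so this
  class is used for the scalars. The real structure on the space, to which \<^const>\<open>convex\<close> refers,
  is required to be the restriction of the given one. Addition is continuous by the class
  \<^class>\<open>topological_ab_group_add\<close>. The Hausdorff property is not included.
\<close>
locale locally_convex_tvs = vector_space scale
  for scale :: "'k::real_normed_field \<Rightarrow> 'y::{real_vector, topological_ab_group_add} \<Rightarrow> 'y" +
  assumes scale_of_real: "scale (of_real r) y = r *\<^sub>R y"
    and continuous_scale: "continuous_on UNIV (\<lambda>(c, y). scale c y)"
    and locally_convex:
      "\<lbrakk>open (U :: 'y set); 0 \<in> U\<rbrakk> \<Longrightarrow> \<exists>C. convex C \<and> 0 \<in> interior C \<and> C \<subseteq> U"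

text \<open>
  A multifunction from \<open>X \<subseteq> 'x\<close> into \<open>'y\<close> is a function \<open>'x \<Rightarrow> 'y set\<close>, whose values outside
  \<open>X\<close> are irrelevant.
\<close>

definition mf_image :: "('x \<Rightarrow> 'y set) \<Rightarrow> 'x set \<Rightarrow> 'y set"
  where "mf_image F A = (\<Union>x\<in>A. F x)"

definition lower_inverse :: "'x set \<Rightarrow> ('x \<Rightarrow> 'y set) \<Rightarrow> 'y set \<Rightarrow> 'x set"
  where "lower_inverse X F B = {x \<in> X. F x \<inter> B \<noteq> {}}"

definition upper_inverse :: "'x set \<Rightarrow> ('x \<Rightarrow> 'y set) \<Rightarrow> 'y set \<Rightarrow> 'x set"
  where "upper_inverse X F B = {x \<in> X. F x \<subseteq> B}"

definition mf_add_scaled ::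
    "('x \<Rightarrow> 'y::real_vector set) \<Rightarrow> real \<Rightarrow> ('x \<Rightarrow> 'y set) \<Rightarrow> 'x \<Rightarrow> 'y set"
  where "mf_add_scaled \<Phi> l \<Psi> x = {u + l *\<^sub>R v | u v. u \<in> \<Phi> x \<and> v \<in> \<Psi> x}"

end

theory Submission
  imports Defs
begin

text \<open>
  For \<open>x \<in> X\<close> let \<open>U x\<close> be the set of all \<open>l\<close> with \<open>\<Phi>(x) + l\<Psi>(x) \<subseteq> Y - E\<close>. It is an open interval,
  because \<open>Y - E\<close> is open and convex and the values are compact, and \<open>l\<close> stays away from its closure
  as soon as \<open>\<Phi>(x) + l\<Psi>(x)\<close> meets the interior of \<open>E\<close>. Take \<open>x0\<close> from \<open>(h2)\<close>; up to a reflection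
  \<open>U x0 \<inter> I\<close> lies to the right of \<open>0\<close>. Applying \<open>(h3)\<close> to the set of those \<open>d \<in> D\<close> that lie to the
  left of some \<open>U x \<inter> I\<close> contained in the positive half-line gives a point \<open>x*\<close> for which
  \<open>a* = inf (U x* \<inter> I)\<close> is the greatest of all these infima. Hence if \<open>U x\<close> meets an interval
  \<open>]a*, b*[ \<subseteq> U x*\<close>, then \<open>a*\<close> is in the closure of \<open>U x\<close>, so \<open>\<Phi>(x) + a*\<Psi>(x)\<close> misses the
  interior of \<open>E\<close>. As \<open>E\<close> is the closure of its interior, the two boundary inclusions follow.
\<close>

section \<open>Sums of compact values against a closed set with convex complement\<close>

lemma (in locally_convex_tvs) continuous_on_scaleR_tvs:
  fixes f :: "'a::topological_space \<Rightarrow> real" and g :: "'a \<Rightarrow> 'y"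
  assumes "continuous_on S f" "continuous_on S g"
  shows "continuous_on S (\<lambda>x. f x *\<^sub>R g x)"
proof -
  have "continuous_on S (\<lambda>x. (of_real (f x) :: 'k, g x))"
    by (intro continuous_intros assms)
  then have "continuous_on S (\<lambda>x. (\<lambda>(c, y). scale c y) (of_real (f x), g x))"
    by (rule continuous_on_compose2[OF continuous_scale]) auto
  then show ?thesis by (simp add: scale_of_real)
qed

text \<open>Extend the segment from a point \<open>c\<close> outside \<open>E\<close> to
  \<open>y\<close> in \<open>E\<close> slightly beyond \<open>y\<close>. The points reached are
  interior to \<open>E\<close>, since otherwise \<open>y\<close> would be a convex combination of
  two points outside \<open>E\<close>; they tend to \<open>y\<close>.\<close>

lemma (in locally_convex_tvs) subset_closure_interior_compl_convex:
  fixes E :: "'y set"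
  assumes "closed E" "convex (UNIV - E)" "E \<noteq> UNIV"
  shows "E \<subseteq> closure (interior E)"
proof
  fix y assume y: "y \<in> E"
  from \<open>E \<noteq> UNIV\<close> obtain c where c: "c \<notin> E" by auto
  define z where "z t = y + t *\<^sub>R (y - c)" for t :: real
  have z_int: "z t \<in> interior E" if t: "t > 0" for t
  proof -
    \<comment> \<open>\<open>W\<close> collects the \<open>w\<close> for which the point
      \<open>c'\<close> with \<open>y = w/(1+t) + t c'/(1+t)\<close> lies outside \<open>E\<close>.
      For \<open>w = z t\<close> this point is \<open>c\<close> itself.\<close>
    define W where "W = (\<lambda>w. (1 / t) *\<^sub>R ((1 + t) *\<^sub>R y - w)) -` (- E)"
    have "open W" unfolding W_def using \<open>closed E\<close>
      by (intro open_vimage continuous_on_scaleR_tvs continuous_intros) auto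
    moreover have "z t \<in> W" using c t by (simp add: W_def z_def algebra_simps)
    moreover have "W \<subseteq> E"
    proof (rule ccontr)
      assume "\<not> W \<subseteq> E"
      then obtain w where w: "w \<in> W" "w \<notin> E" by auto
      define c' where "c' = (1 / t) *\<^sub>R ((1 + t) *\<^sub>R y - w)"
      have "c' \<notin> E" using w by (simp add: W_def c'_def)
      have "(1 / (1 + t)) *\<^sub>R w + (t / (1 + t)) *\<^sub>R c' \<in> UNIV - E"
        using w \<open>c' \<notin> E\<close> t by (intro convexD[OF \<open>convex (UNIV - E)\<close>]) (auto simp: field_simps)
      moreover have "(t / (1 + t)) *\<^sub>R c' = y - (1 / (1 + t)) *\<^sub>R w"
        using t by (simp add: c'_def scaleR_diff_right)
      ultimately show False using y by simp
    qed
    ultimately show ?thesis by (auto simp: interior_def)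
  qed
  show "y \<in> closure (interior E)"
    unfolding closure_iff_nhds_not_empty
  proof (intro allI impI)
    fix A V assume "V \<subseteq> A" "open V" "y \<in> V"
    have "open (z -` V)" unfolding z_def using \<open>open V\<close>
      by (intro open_vimage continuous_on_scaleR_tvs continuous_intros) auto
    moreover have "0 \<in> z -` V" using \<open>y \<in> V\<close> by (simp add: z_def)
    ultimately obtain e where e: "e > 0" "ball 0 e \<subseteq> z -` V"
      unfolding open_contains_ball by blast
    then have "z (e / 2) \<in> V" by (auto simp: subset_iff)
    with z_int[of "e / 2"] e \<open>V \<subseteq> A\<close> show "interior E \<inter> A \<noteq> {}" by auto
  qed
qed

text \<open>The triples \<open>(l, u, v)\<close> with \<open>u + l v\<close> in \<open>C\<close>
  form an open set; if it contains the compact slice over \<open>l\<close>, the tube lemma gives the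
  same for all nearby parameters.\<close>

lemma (in locally_convex_tvs) open_mf_add_scaled_subset:
  fixes \<Phi> \<Psi> :: "'x \<Rightarrow> 'y set"
  assumes "open C" "compact (\<Phi> x)" "compact (\<Psi> x)"
  shows "open {l. mf_add_scaled \<Phi> l \<Psi> x \<subseteq> C}"
proof (subst open_subopen, clarify)
  fix l assume l: "mf_add_scaled \<Phi> l \<Psi> x \<subseteq> C"
  define W where "W = (\<lambda>p. fst (snd p) + fst p *\<^sub>R snd (snd p)) -` C"
  have "open W" unfolding W_def using \<open>open C\<close>
    by (intro open_vimage continuous_on_scaleR_tvs continuous_intros) auto
  moreover have "{l} \<times> (\<Phi> x \<times> \<Psi> x) \<subseteq> W"
    using l by (force simp: W_def mf_add_scaled_def)
  ultimately obtain T where T: "l \<in> T" "open T" "T \<times> (\<Phi> x \<times> \<Psi> x) \<subseteq> W"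
    using Elementary_Topology.tube_lemma[OF compact_Times[OF assms(2,3)]] by metis
  then show "\<exists>T. open T \<and> l \<in> T \<and> T \<subseteq> {l. mf_add_scaled \<Phi> l \<Psi> x \<subseteq> C}"
    by (intro exI[of _ T]) (auto simp: W_def mf_add_scaled_def subset_iff)
qed

text \<open>The set is an intersection, over \<open>u\<close> and \<open>v\<close>, of preimages of
  \<open>C\<close> under the affine maps sending \<open>l\<close> to \<open>u + l v\<close>.\<close>

lemma convex_mf_add_scaled_subset:
  assumes "convex C"
  shows "convex {l. mf_add_scaled \<Phi> l \<Psi> x \<subseteq> C}"
proof (rule convexI, clarify)
  fix l m s t :: real and y
  assume l: "mf_add_scaled \<Phi> l \<Psi> x \<subseteq> C" and m: "mf_add_scaled \<Phi> m \<Psi> x \<subseteq> C"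
    and st: "0 \<le> s" "0 \<le> t" "s + t = 1"
    and y: "y \<in> mf_add_scaled \<Phi> (s *\<^sub>R l + t *\<^sub>R m) \<Psi> x"
  from y obtain u v where uv: "u \<in> \<Phi> x" "v \<in> \<Psi> x" "y = u + (s * l + t * m) *\<^sub>R v"
    by (auto simp: mf_add_scaled_def)
  have "s *\<^sub>R (u + l *\<^sub>R v) + t *\<^sub>R (u + m *\<^sub>R v) \<in> C"
    using l m uv st by (intro convexD[OF \<open>convex C\<close>]) (auto simp: mf_add_scaled_def)
  also have "s *\<^sub>R (u + l *\<^sub>R v) + t *\<^sub>R (u + m *\<^sub>R v) = (s + t) *\<^sub>R u + (s * l + t * m) *\<^sub>R v"
    by (simp add: algebra_simps)
  finally show "y \<in> C" using st uv by simp
qed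

text \<open>Fix \<open>u\<close> and \<open>v\<close> with \<open>u + a v\<close> interior to
  \<open>E\<close>: then \<open>u + l v\<close> stays in \<open>E\<close> for all \<open>l\<close>
  near \<open>a\<close>.\<close>

lemma (in locally_convex_tvs) not_in_closure_if_meets_interior:
  fixes \<Phi> \<Psi> :: "'x \<Rightarrow> 'y set"
  assumes "mf_add_scaled \<Phi> a \<Psi> x \<inter> interior E \<noteq> {}"
  shows "a \<notin> closure {l. mf_add_scaled \<Phi> l \<Psi> x \<subseteq> UNIV - E}"
proof -
  obtain u v where uv: "u \<in> \<Phi> x" "v \<in> \<Psi> x" "u + a *\<^sub>R v \<in> interior E"
    using assms by (auto simp: mf_add_scaled_def)
  define T where "T = (\<lambda>l. u + l *\<^sub>R v) -` interior E"
  have "open T" unfolding T_def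
    by (intro open_vimage continuous_on_scaleR_tvs continuous_intros) auto
  moreover have "a \<in> T" using uv by (simp add: T_def)
  moreover have "{l. mf_add_scaled \<Phi> l \<Psi> x \<subseteq> UNIV - E} \<inter> T = {}"
    using uv interior_subset[of E] by (force simp: T_def mf_add_scaled_def)
  ultimately show ?thesis
    by (metis (lifting) closure_iff_nhds_not_empty order_refl)
qed

text \<open>The open set \<open>interior P\<close> misses \<open>interior E\<close>, hence also its
  closure, which contains \<open>E\<close>. So a common point of \<open>P\<close> and
  \<open>E\<close> is interior to neither.\<close>

lemma subset_frontiers_if_disjoint_interior:
  assumes "E \<subseteq> closure (interior E)" "P \<inter> interior E = {}"
  shows "P \<inter> E \<subseteq> frontier P \<inter> frontier E"
proof -
  have "interior P \<inter> closure (interior E) = {}"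
    using assms(2) interior_subset[of P] open_Int_closure_eq_empty[OF open_interior] by blast
  then show ?thesis
    using assms closure_subset[of P] closure_subset[of E] by (auto simp: frontier_def)
qed

section \<open>The extremal interval on the real line\<close>

text \<open>This isolates the one-dimensional core: \<open>U x\<close> plays the set of parameters
  whose value at \<open>x\<close> avoids \<open>E\<close>, and \<open>fip\<close> is the hypothesis
  \<open>(h3)\<close> read through the complements of the \<open>U x\<close>.\<close>

lemma extremal_interval:
  fixes U :: "'x \<Rightarrow> real set"
  assumes I: "is_interval I" "0 \<in> I"
    and U: "\<And>x. x \<in> X \<Longrightarrow> open (U x) \<and> convex (U x) \<and> U x \<inter> I \<noteq> {}"
    and D: "D \<subseteq> I" "I \<subseteq> closure D"
    and fip: "\<And>A. A \<subseteq> D \<Longrightarrow> (\<And>B. B \<subseteq> A \<Longrightarrow> finite B \<Longrightarrow> \<exists>x\<in>X. (B \<union> {0}) \<inter> U x = {})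
      \<Longrightarrow> \<exists>x\<in>X. (A \<union> {0}) \<inter> U x = {}"
    and x0: "x0 \<in> X" "0 \<notin> closure (U x0)" "U x0 \<inter> I \<subseteq> {0<..}"
  obtains a b xs where "0 < a" "a < b" "{a..b} \<subseteq> I" "xs \<in> X" "0 \<notin> U xs" "a \<notin> U xs"
    "{a<..<b} \<subseteq> U xs" "\<And>x. x \<in> X \<Longrightarrow> U x \<inter> {a<..<b} \<noteq> {} \<Longrightarrow> a \<in> closure (U x)"
proof -
  have mem_I: "m \<in> I" if "0 \<le> m" "m \<le> n" "n \<in> I" for m n
    using mem_is_interval_1_I[OF I(1)] I(2) that by metis
  have away: "\<exists>e>0. \<forall>y. \<bar>y - c\<bar> < e \<longrightarrow> y \<notin> S" if "c \<notin> closure S" for c :: real and S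
    using that by (force simp: closure_approachable dist_real_def)
  \<comment> \<open>The \<open>max 0 d\<close> makes the witness \<open>x\<close> for
    \<open>d\<close> avoid the parameter 0 as well.\<close>
  define A where "A = {d \<in> D. \<exists>x\<in>X. U x \<inter> I \<subseteq> {max 0 d<..}}"
  have "\<exists>x\<in>X. (A \<union> {0}) \<inter> U x = {}"
  proof (rule fip)
    show "A \<subseteq> D" by (auto simp: A_def)
    fix B assume B: "B \<subseteq> A" "finite B"
    show "\<exists>x\<in>X. (B \<union> {0}) \<inter> U x = {}"
    proof (cases "B = {}")
      case True
      then show ?thesis using x0 I by (intro bexI[of _ x0]) auto
    next
      case False
      \<comment> \<open>The witness for the largest element of \<open>B\<close> serves all of
        \<open>B\<close> at once.\<close>
      then have "Max B \<in> A" using B Max_in by blast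
      then obtain x where x: "x \<in> X" "U x \<inter> I \<subseteq> {max 0 (Max B)<..}" by (auto simp: A_def)
      have "l \<notin> U x" if "l \<in> B \<union> {0}" for l
      proof -
        have "l \<in> I" using that B D I by (auto simp: A_def)
        moreover have "l \<le> max 0 (Max B)"
          using that Max_ge[OF B(2), of l] by auto
        ultimately show ?thesis using x by (auto simp: subset_iff)
      qed
      then show ?thesis using x by blast
    qed
  qed
  then obtain xs where xs: "xs \<in> X" "(A \<union> {0}) \<inter> U xs = {}" by blast
  \<comment> \<open>An open set meeting \<open>I\<close> meets \<open>D\<close>, and
    \<open>U xs\<close> contains no point of \<open>A\<close>.\<close>
  have dense: "\<exists>d\<in>D - A. d \<in> U xs \<inter> W" if "g \<in> U xs \<inter> I" "g \<in> W" "open W" for g W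
  proof -
    have "(U xs \<inter> W) \<inter> D \<noteq> {}"
      using open_Int_closure_eq_empty[of "U xs \<inter> W" D] that U[OF xs(1)] D by blast
    then show ?thesis using xs by blast
  qed
  \<comment> \<open>Maximality of \<open>xs\<close>: a point of \<open>U xs\<close> in
    \<open>I\<close> below \<open>e\<close> would yield some \<open>d < e\<close> in
    \<open>D - A\<close>, yet \<open>x\<close> witnesses that \<open>d\<close> is in
    \<open>A\<close>.\<close>
  have sep: "e \<le> g"
    if g: "g \<in> U xs \<inter> I" and x: "x \<in> X" "U x \<inter> I \<subseteq> {0<..}" "U x \<inter> I \<subseteq> {e<..}" for g x e
  proof (rule ccontr)
    assume "\<not> e \<le> g"
    then obtain d where "d \<in> D - A" "d < e" using dense[of g "{..<e}"] g by auto
    then show False using x by (force simp: A_def)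
  qed
  have pos: "U xs \<inter> I \<subseteq> {0<..}"
  proof
    fix g assume g: "g \<in> U xs \<inter> I"
    show "g \<in> {0<..}"
    proof (rule ccontr)
      assume "g \<notin> {0<..}"
      moreover have "g \<noteq> 0" using g xs by auto
      ultimately obtain d where "d \<in> D - A" "d < 0" using dense[of g "{..<0}"] g by auto
      then show False using x0 by (force simp: A_def)
    qed
  qed
  obtain e where e: "e > 0" "\<And>y. \<bar>y\<bar> < e \<Longrightarrow> y \<notin> U x0" using away[OF x0(2)] by auto
  \<comment> \<open>Comparison with \<open>x0\<close> keeps the infimum \<open>a\<close> away from
    0, which \<open>0 \<notin> U xs\<close> alone would not do.\<close>
  have "U x0 \<inter> I \<subseteq> {e/2<..}"
  proof
    fix y assume "y \<in> U x0 \<inter> I"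
    then show "y \<in> {e/2<..}" using x0(3) e(2)[of y] e(1) by fastforce
  qed
  then have lower: "e / 2 \<le> g" if "g \<in> U xs \<inter> I" for g using sep[OF that] x0 by blast
  define a where "a = Inf (U xs \<inter> I)"
  have ne: "U xs \<inter> I \<noteq> {}" using U[OF xs(1)] by blast
  have bdd: "bdd_below (U xs \<inter> I)" by (rule bdd_belowI[of _ "e / 2"]) (rule lower)
  have a_pos: "0 < a" using cInf_greatest[OF ne lower] e by (auto simp: a_def)
  have a_le: "a \<le> g" if "g \<in> U xs \<inter> I" for g
    using cInf_lower[OF that bdd] by (simp add: a_def)
  obtain b where b: "b \<in> U xs" "b \<in> I" using ne by blast
  have sub_I: "{a..b} \<subseteq> I" using mem_I b a_pos by fastforce
  then have a_I: "a \<in> I" using a_le b by auto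
  have a_notin: "a \<notin> U xs"
  proof
    assume "a \<in> U xs"
    then obtain r where r: "r > 0" "ball a r \<subseteq> U xs"
      using U[OF xs(1)] by (auto simp: open_contains_ball)
    \<comment> \<open>A point just left of \<open>a\<close>: the bound \<open>a - r / 2\<close>
      keeps it in the ball, and \<open>a / 2\<close> keeps it positive, hence in
      \<open>I\<close>.\<close>
    define m where "m = max (a / 2) (a - r / 2)"
    have "m \<in> U xs" using r a_pos by (auto simp: m_def subset_iff dist_real_def max_def)
    moreover have "m \<in> I" using mem_I[OF _ _ a_I, of m] a_pos r by (auto simp: m_def)
    ultimately show False using a_le[of m] r a_pos by (auto simp: m_def)
  qed
  then have ab: "a < b" using a_le[of b] b by (cases "a = b") auto
  have ex_less: "\<exists>g\<in>U xs \<inter> I. g < l" if "a < l" for l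
    using cInf_lessD[OF ne] that by (auto simp: a_def)
  have ivl: "m \<in> U x" if "x \<in> X" "k \<in> U x" "n \<in> U x" "k \<le> m" "m \<le> n" for x k m n
    using U[OF that(1)] mem_is_interval_1_I that(2-) by (metis is_interval_convex_1)
  have "{a<..<b} \<subseteq> U xs"
  proof
    fix l assume l: "l \<in> {a<..<b}"
    then obtain g where "g \<in> U xs \<inter> I" "g < l" using ex_less[of l] by auto
    then show "l \<in> U xs" using ivl[OF xs(1), of g b l] b l by auto
  qed
  moreover have "a \<in> closure (U x)" if x: "x \<in> X" "U x \<inter> {a<..<b} \<noteq> {}" for x
  proof (rule ccontr)
    assume "a \<notin> closure (U x)"
    then obtain r where r: "r > 0" "\<And>y. \<bar>y - a\<bar> < r \<Longrightarrow> y \<notin> U x" using away by blast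
    obtain l where l: "l \<in> U x" "a < l" using x by auto
    \<comment> \<open>\<open>U x\<close> is an interval with a point \<open>l > a\<close> and no
      point within \<open>r\<close> of \<open>a\<close>, so it lies entirely to the right. Then
      \<open>sep\<close> would push the infimum of \<open>U xs \<inter> I\<close> beyond
      \<open>a\<close>.\<close>
    have gap: "a + r / 2 < m" if "m \<in> U x" for m
    proof (rule ccontr)
      assume "\<not> a + r / 2 < m"
      then have "m \<le> a" using r(2)[of m] r(1) that by (cases "m \<le> a") auto
      then have "a \<in> U x" using ivl[OF x(1) that l(1)] l by auto
      then show False using r by auto
    qed
    obtain g where g: "g \<in> U xs \<inter> I" "g < a + r / 2" using ex_less[of "a + r / 2"] r by auto
    have "a + r / 2 \<le> g"
      by (rule sep[OF g(1) x(1)]) (use gap a_pos r in force)+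
    then show False using g by simp
  qed
  ultimately show ?thesis using that[OF a_pos ab sub_I xs(1) _ a_notin] xs by blast
qed

text \<open>Apply \<open>extremal_interval\<close> to the images of \<open>I\<close>,
  \<open>D\<close> and the \<open>U x\<close> under negation; the right endpoint takes over the role
  of the left one.\<close>

lemma extremal_interval_reflected:
  fixes U :: "'x \<Rightarrow> real set"
  assumes I: "is_interval I" "0 \<in> I"
    and U: "\<And>x. x \<in> X \<Longrightarrow> open (U x) \<and> convex (U x) \<and> U x \<inter> I \<noteq> {}"
    and D: "D \<subseteq> I" "I \<subseteq> closure D"
    and fip: "\<And>A. A \<subseteq> D \<Longrightarrow> (\<And>B. B \<subseteq> A \<Longrightarrow> finite B \<Longrightarrow> \<exists>x\<in>X. (B \<union> {0}) \<inter> U x = {})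
      \<Longrightarrow> \<exists>x\<in>X. (A \<union> {0}) \<inter> U x = {}"
    and x0: "x0 \<in> X" "0 \<notin> closure (U x0)" "U x0 \<inter> I \<subseteq> {..<0}"
  obtains a b xs where "b < 0" "a < b" "{a..b} \<subseteq> I" "xs \<in> X" "0 \<notin> U xs" "b \<notin> U xs"
    "{a<..<b} \<subseteq> U xs" "\<And>x. x \<in> X \<Longrightarrow> U x \<inter> {a<..<b} \<noteq> {} \<Longrightarrow> b \<in> closure (U x)"
proof -
  have cl: "closure (uminus ` S) = uminus ` closure S" for S :: "real set"
    by (rule closure_injective_linear_image[symmetric]) (auto simp: linear_uminus)
  have neg_Int: "uminus ` S \<inter> uminus ` T = uminus ` (S \<inter> T)" for S T :: "real set"
    by auto
  have neg_disj: "(uminus ` B \<union> {0}) \<inter> T = {} \<longleftrightarrow> (B \<union> {0}) \<inter> uminus ` T = {}"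
    for B T :: "real set" by force
  obtain a b xs where *: "0 < a" "a < b" "{a..b} \<subseteq> uminus ` I" "xs \<in> X" "0 \<notin> uminus ` U xs"
    "a \<notin> uminus ` U xs" "{a<..<b} \<subseteq> uminus ` U xs"
    "\<And>x. x \<in> X \<Longrightarrow> uminus ` U x \<inter> {a<..<b} \<noteq> {} \<Longrightarrow> a \<in> closure (uminus ` U x)"
  proof (rule extremal_interval[of "uminus ` I" X "\<lambda>x. uminus ` U x" "uminus ` D" x0])
    show "is_interval (uminus ` I)" "0 \<in> uminus ` I" using I by auto
    show "open (uminus ` U x) \<and> convex (uminus ` U x) \<and> uminus ` U x \<inter> uminus ` I \<noteq> {}"
      if "x \<in> X" for x
      using U[OF that] by (auto simp: neg_Int intro: open_negations convex_negations)
    show "uminus ` D \<subseteq> uminus ` I" "uminus ` I \<subseteq> closure (uminus ` D)"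
      using D by (auto simp: cl)
    show "x0 \<in> X" "0 \<notin> closure (uminus ` U x0)" "uminus ` U x0 \<inter> uminus ` I \<subseteq> {0<..}"
      using x0 by (auto simp: cl neg_Int)
    fix A :: "real set"
    assume A: "A \<subseteq> uminus ` D"
      and fin: "\<And>B. B \<subseteq> A \<Longrightarrow> finite B \<Longrightarrow> \<exists>x\<in>X. (B \<union> {0}) \<inter> uminus ` U x = {}"
    have "\<exists>x\<in>X. (uminus ` A \<union> {0}) \<inter> U x = {}"
    proof (rule fip)
      show "uminus ` A \<subseteq> D" using A by auto
      fix B assume B: "B \<subseteq> uminus ` A" "finite B"
      then have "\<exists>x\<in>X. (uminus ` B \<union> {0}) \<inter> uminus ` U x = {}" by (intro fin) auto
      then show "\<exists>x\<in>X. (B \<union> {0}) \<inter> U x = {}" 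
        unfolding neg_disj by (simp add: image_image)
    qed
    then show "\<exists>x\<in>X. (A \<union> {0}) \<inter> uminus ` U x = {}"
      unfolding neg_disj by (simp add: image_image)
  qed (rule that; blast)
  have mem: "y \<in> uminus ` S \<longleftrightarrow> - y \<in> S" for y :: real and S by force
  show ?thesis
  proof (rule that[of "- a" "- b" xs])
    show "{- b..- a} \<subseteq> I" "{- b<..<- a} \<subseteq> U xs"
      using *(3,7) by (auto simp: subset_iff mem)
        (metis add.inverse_inverse minus_le_iff le_minus_iff minus_less_iff less_minus_iff)+
    fix x assume "x \<in> X" "U x \<inter> {- b<..<- a} \<noteq> {}"
    then show "- a \<in> closure (U x)" using *(8)[of x] by (force simp: cl mem)
  qed (use * in \<open>auto simp: mem\<close>)
qed

section \<open>Transfer to the multifunctions\<close>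

theorem theorem2:
  fixes X :: "'x set"
    and scale :: "'k::real_normed_field \<Rightarrow> 'y::{real_vector, topological_ab_group_add, t2_space} \<Rightarrow> 'y"
    and E :: "'y set"
    and I :: "real set"
    and \<Phi> \<Psi> :: "'x \<Rightarrow> 'y set"
  assumes "X \<noteq> {}"
    and "locally_convex_tvs scale"
    and "closed E"
    and "convex (UNIV - E)"
    and "connected I" and "\<exists>s\<in>I. \<exists>t\<in>I. s \<noteq> t" and "0 \<in> I"
    and "\<And>x. x \<in> X \<Longrightarrow> \<Phi> x \<noteq> {} \<and> compact (\<Phi> x)"
    and "\<And>x. x \<in> X \<Longrightarrow> \<Psi> x \<noteq> {} \<and> compact (\<Psi> x)"
    and h1: "\<And>x. x \<in> X \<Longrightarrow> \<exists>l\<in>I. mf_add_scaled \<Phi> l \<Psi> x \<subseteq> UNIV - E"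
    and h2: "lower_inverse X \<Phi> (interior E) \<noteq> {}"
    and h3: "\<exists>D. D \<subseteq> I \<and> I \<subseteq> closure D \<and>
      (\<forall>A\<subseteq>D.
        (\<forall>B\<subseteq>A. finite B \<longrightarrow>
          (\<Inter>l\<in>B \<union> {0}. lower_inverse X (mf_add_scaled \<Phi> l \<Psi>) E) \<noteq> {}) \<longrightarrow>
        (\<Inter>l\<in>A \<union> {0}. lower_inverse X (mf_add_scaled \<Phi> l \<Psi>) E) \<noteq> {})"
  shows "\<exists>a b xs. a < b \<and> {a..b} \<subseteq> I \<and> xs \<in> lower_inverse X \<Phi> E \<and>
    (\<Union>l\<in>{a<..<b}. mf_add_scaled \<Phi> l \<Psi> xs) \<subseteq> UNIV - E \<and>
    (let V = (\<Union>l\<in>{a<..<b}. upper_inverse X (mf_add_scaled \<Phi> l \<Psi>) (UNIV - E));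
         q1 = (a > 0 \<and> mf_add_scaled \<Phi> a \<Psi> xs \<inter> E \<noteq> {} \<and>
               mf_image (mf_add_scaled \<Phi> a \<Psi>) V \<inter> E
                 \<subseteq> frontier (mf_image (mf_add_scaled \<Phi> a \<Psi>) V) \<inter> frontier E);
         q2 = (b < 0 \<and> mf_image (mf_add_scaled \<Phi> b \<Psi>) V \<inter> E \<noteq> {} \<and>
               mf_image (mf_add_scaled \<Phi> b \<Psi>) V \<inter> E
                 \<subseteq> frontier (mf_image (mf_add_scaled \<Phi> b \<Psi>) V) \<inter> frontier E)
     in (q1 \<or> q2) \<and>
        (bdd_below I \<and> Inf I = 0 \<longrightarrow> q1) \<and>
        (bdd_above I \<and> Sup I = 0 \<longrightarrow> q2))"
  proof -
  interpret locally_convex_tvs scale by fact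
  define U where "U x = {l. mf_add_scaled \<Phi> l \<Psi> x \<subseteq> UNIV - E}" for x
  have I: "is_interval I" using \<open>connected I\<close> by (simp add: is_interval_connected_1)
  have U: "open (U x) \<and> convex (U x) \<and> U x \<inter> I \<noteq> {}" if "x \<in> X" for x
    unfolding U_def using assms(3,4,8,9) h1[OF that] that
    by (auto intro!: open_mf_add_scaled_subset convex_mf_add_scaled_subset)
  \<comment> \<open>The value at \<open>x\<close> meets \<open>E\<close> exactly for the parameters
    outside \<open>U x\<close>; this turns \<open>(h3)\<close> into \<open>fip\<close>.\<close>
  have meets: "(\<Inter>l\<in>B \<union> {0}. lower_inverse X (mf_add_scaled \<Phi> l \<Psi>) E) \<noteq> {}
      \<longleftrightarrow> (\<exists>x\<in>X. (B \<union> {0}) \<inter> U x = {})" for B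
    unfolding U_def lower_inverse_def by fastforce
  obtain D where D: "D \<subseteq> I" "I \<subseteq> closure D"
    and fip: "\<And>A. A \<subseteq> D \<Longrightarrow> (\<And>B. B \<subseteq> A \<Longrightarrow> finite B \<Longrightarrow> \<exists>x\<in>X. (B \<union> {0}) \<inter> U x = {})
      \<Longrightarrow> \<exists>x\<in>X. (A \<union> {0}) \<inter> U x = {}"
    using h3 unfolding meets by blast
  have add_0: "mf_add_scaled \<Phi> 0 \<Psi> x = \<Phi> x" if "x \<in> X" for x
    using assms(9)[OF that] by (auto simp: mf_add_scaled_def)
  obtain x0 where x0: "x0 \<in> X" "\<Phi> x0 \<inter> interior E \<noteq> {}"
    using h2 by (auto simp: lower_inverse_def)
  have x0_cl: "0 \<notin> closure (U x0)"
    unfolding U_def by (rule not_in_closure_if_meets_interior) (simp add: add_0 x0)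
  have "E \<noteq> UNIV" using U[OF x0(1)] x0 assms(8,9) by (force simp: U_def mf_add_scaled_def)
  then have E: "E \<subseteq> closure (interior E)"
    using assms(3,4) by (intro subset_closure_interior_compl_convex)
  have in_lower: "x \<in> lower_inverse X \<Phi> E" if "x \<in> X" "0 \<notin> U x" for x
    using that add_0[OF that(1)] by (auto simp: lower_inverse_def U_def)
  have hits: "mf_add_scaled \<Phi> l \<Psi> x \<inter> E \<noteq> {}" if "l \<notin> U x" for l x
    using that by (auto simp: U_def)
  \<comment> \<open>Stated for a general \<open>c\<close>, to be used with either endpoint. A point
    \<open>x\<close> of \<open>X\<close> lies in \<open>V\<close> exactly when \<open>U x\<close>
    meets the open interval from \<open>a\<close> to \<open>b\<close>.\<close>
  have frontier: "mf_image (mf_add_scaled \<Phi> c \<Psi>) V \<inter> E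
      \<subseteq> frontier (mf_image (mf_add_scaled \<Phi> c \<Psi>) V) \<inter> frontier E"
    if cl: "\<And>x. x \<in> X \<Longrightarrow> U x \<inter> {a<..<b} \<noteq> {} \<Longrightarrow> c \<in> closure (U x)"
      and V: "V = (\<Union>l\<in>{a<..<b}. upper_inverse X (mf_add_scaled \<Phi> l \<Psi>) (UNIV - E))" for a b c V
  proof (rule subset_frontiers_if_disjoint_interior[OF E])
    have "mf_add_scaled \<Phi> c \<Psi> x \<inter> interior E = {}" if "x \<in> V" for x
    proof (rule ccontr)
      assume "mf_add_scaled \<Phi> c \<Psi> x \<inter> interior E \<noteq> {}"
      then have "c \<notin> closure (U x)" unfolding U_def by (rule not_in_closure_if_meets_interior)
      moreover have "x \<in> X" "U x \<inter> {a<..<b} \<noteq> {}"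
        using that V by (auto simp: upper_inverse_def U_def)
      ultimately show False using cl by blast
    qed
    then show "mf_image (mf_add_scaled \<Phi> c \<Psi>) V \<inter> interior E = {}"
      by (auto simp: mf_image_def)
  qed
  have "0 \<notin> U x0" using x0_cl closure_subset by blast
  \<comment> \<open>\<open>U x0\<close> is an interval missing 0. Its side decides between
    \<open>(q1)\<close> and \<open>(q2)\<close>.\<close>
  have "U x0 \<inter> I \<subseteq> {0<..} \<or> U x0 \<inter> I \<subseteq> {..<0}"
  proof (rule ccontr)
    assume "\<not> ?thesis"
    then obtain s t where "s \<in> U x0" "s \<le> 0" "t \<in> U x0" "0 \<le> t"
      by (force simp: not_less subset_iff)
    then have "0 \<in> U x0"
      using U[OF x0(1)] mem_is_interval_1_I by (metis is_interval_convex_1)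
    with \<open>0 \<notin> U x0\<close> show False ..
  qed
  then show ?thesis
  proof
    assume right: "U x0 \<inter> I \<subseteq> {0<..}"
    obtain a b xs where *: "0 < a" "a < b" "{a..b} \<subseteq> I" "xs \<in> X" "0 \<notin> U xs" "a \<notin> U xs"
      "{a<..<b} \<subseteq> U xs" "\<And>x. x \<in> X \<Longrightarrow> U x \<inter> {a<..<b} \<noteq> {} \<Longrightarrow> a \<in> closure (U x)"
      by (rule extremal_interval[of I X U D x0, OF I \<open>0 \<in> I\<close> U D fip x0(1) x0_cl right])
        (assumption | (rule that; blast) | blast)+
    \<comment> \<open>Here \<open>I\<close> contains \<open>b > 0\<close>, so the clause for
      \<open>0 = sup I\<close> holds vacuously; the other case is symmetric.\<close>
    have "\<not> (bdd_above I \<and> Sup I = 0)"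
      using *(1,2) subsetD[OF *(3), of b] cSup_upper[of b I] by auto
    then show ?thesis unfolding Let_def
      using * in_lower[OF *(4,5)] hits[OF *(6)] frontier[OF *(8) refl]
      by (intro exI[of _ a] exI[of _ b] exI[of _ xs]) (auto simp: U_def)
  next
    assume left: "U x0 \<inter> I \<subseteq> {..<0}"
    obtain a b xs where *: "b < 0" "a < b" "{a..b} \<subseteq> I" "xs \<in> X" "0 \<notin> U xs" "b \<notin> U xs"
      "{a<..<b} \<subseteq> U xs" "\<And>x. x \<in> X \<Longrightarrow> U x \<inter> {a<..<b} \<noteq> {} \<Longrightarrow> b \<in> closure (U x)"
      by (rule extremal_interval_reflected[of I X U D x0, OF I \<open>0 \<in> I\<close> U D fip x0(1) x0_cl left])
        (assumption | (rule that; blast) | blast)+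
    let ?V = "\<Union>l\<in>{a<..<b}. upper_inverse X (mf_add_scaled \<Phi> l \<Psi>) (UNIV - E)"
    have "\<not> (bdd_below I \<and> Inf I = 0)"
      using *(1,2) subsetD[OF *(3), of a] cInf_lower[of a I] by auto
    \<comment> \<open>\<open>(q2)\<close> asks that the image of \<open>V\<close>, rather than the
      value at \<open>xs\<close>, meets \<open>E\<close>. The value at \<open>xs\<close> does meet
      it, so it suffices that \<open>xs\<close> is in \<open>V\<close>, which holds because the
      interval is non-empty.\<close>
    moreover have "xs \<in> ?V"
      using *(2,4,7) dense[OF *(2)] by (auto simp: upper_inverse_def U_def subset_iff)
    then have "mf_image (mf_add_scaled \<Phi> b \<Psi>) ?V \<inter> E \<noteq> {}"
      using hits[OF *(6)] unfolding mf_image_def by blast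
    moreover have "(\<Union>l\<in>{a<..<b}. mf_add_scaled \<Phi> l \<Psi> xs) \<subseteq> UNIV - E"
      using *(7) by (auto simp: U_def)
    ultimately show ?thesis unfolding Let_def
      using *(1-3) in_lower[OF *(4,5)] frontier[OF *(8) refl]
      by (intro exI[of _ a] exI[of _ b] exI[of _ xs]) auto
  qed
qed

end
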